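(* For every $D\ge0$, the classes $\mathscr H(D)$ and $\mathscr S(D)$ are invariant under: (i) all orientation-preserving real-affine postcompositions; (ii) precomposition with all conformal automorphisms of the source disk $\mathbb D$; (iii) all target similarities and the normalizations used in harmonic Koebe transforms. Furthermore, $$\mathscr H(0)=\{A\circ\varphi:\ \varphi:\mathbb D\to\mathbb C\text{ analytic and locally univalent},\ A\text{ an orientation-preserving real-affine mapping}\},$$ and similarly $\mathscr S(0)$ is the set of all $A\circ\varphi$ with $\varphi$ analytic and univalent in $\mathbb D$ and $A$ orientation-preserving real-affine.
   Context: $\mathbb D$ is the open unit disk in $\mathbb C$. An orientation-preserving (sense-preserving) harmonic mapping in $\mathbb D$ is a complex-valued harmonic function $f=h+\overline g$, with $h,g$ analytic in $\mathbb D$, whose Jacobian $|h'|^2-|g'|^2$ is positive everywhere; its complex dilatation $\omega_f=g'/h'$ is an analytic map $\mathbb D\to\mathbb D$. Univalent means injective. $\|\cdot\|_\infty$ is the supremum norm on $\mathbb D$. Hyperbolic distance: $d_{\mathbb D}(z_1,z_2)=2\operatorname{arctanh}\left|\frac{z_1-z_2}{1-\overline{z_2}z_1}\right|$. For $\|\omega_f\|_\infty<1$, $d_{\mathrm{aff}}(f)=\sup\{d_{\mathbb D}(\zeta,\eta):\zeta,\eta\in\overline{\omega_f(\mathbb D)}\}$. $\mathscr H(D)$ is the class of sense-preserving harmonic $f:\mathbb D\to\mathbb C$ with $\|\omega_f\|_\infty<1$ and $d_{\mathrm{aff}}(f)\le D$; $\mathscr S(D)$ is its subfamily of univalent mappings.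 Orientation-preserving real-affine mappings: $A(w)=aw+b\overline w+c$, $|a|>|b|$. Similarities: $S(w)=\lambda w+\gamma$, $\lambda\neq0$. The harmonic Koebe transform for $\phi\in\operatorname{Aut}(\mathbb D)$ is $\mathcal K_\phi f(z)=\frac{f(\phi(z))-f(\phi(0))}{f_z(\phi(0))\phi'(0)}$; its normalization is the subtraction of the value and division by the $z$-derivative at the origin. *)

theory Defs
  imports "HOL-Analysis.Analysis"
begin

text \<open>
  Mappings of the unit disk are represented by total functions \<open>complex \<Rightarrow> complex\<close>; every notion
  below depends only on the values on the unit disk.
\<close>

abbreviation unit_disk :: "complex set" where
  "unit_disk \<equiv> ball 0 1"

definition harmonic_decomp ::
  "(complex \<Rightarrow> complex) \<Rightarrow> (complex \<Rightarrow> complex) \<Rightarrow> (complex \<Rightarrow> complex) \<Rightarrow> bool" where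
  "harmonic_decomp f h g \<longleftrightarrow>
     h holomorphic_on unit_disk \<and> g holomorphic_on unit_disk \<and>
     (\<forall>z\<in>unit_disk. f z = h z + cnj (g z))"

text \<open>
  The parts \<open>h\<close>, \<open>g\<close> are unique on the disk up to additive constants, so their derivatives depend
  only on \<open>f\<close>; see \<open>dilatation_eq\<close> below.
\<close>

definition sense_preserving_harmonic :: "(complex \<Rightarrow> complex) \<Rightarrow> bool" where
  "sense_preserving_harmonic f \<longleftrightarrow>
     (\<exists>h g. harmonic_decomp f h g \<and>
        (\<forall>z\<in>unit_disk. (cmod (deriv h z))\<^sup>2 - (cmod (deriv g z))\<^sup>2 > 0))"

definition dilatation :: "(complex \<Rightarrow> complex) \<Rightarrow> complex \<Rightarrow> complex" where
  "dilatation f z = (THE w. \<exists>h g. harmonic_decomp f h g \<and> w = deriv g z / deriv h z)"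

definition disk_sup_norm :: "(complex \<Rightarrow> complex) \<Rightarrow> real" where
  "disk_sup_norm w = (SUP z\<in>unit_disk. cmod (w z))"

definition hyp_dist :: "complex \<Rightarrow> complex \<Rightarrow> real" where
  "hyp_dist z1 z2 = 2 * artanh (cmod ((z1 - z2) / (1 - cnj z2 * z1)))"

text \<open>
  The real-valued suprema in \<open>disk_sup_norm\<close> and \<open>d_aff\<close> are used only where they are finite:
  \<open>cmod (dilatation f z) < 1\<close> on the disk if \<open>f\<close> is sense-preserving, and the closure in \<open>d_aff\<close> is a
  compact subset of the open disk if moreover \<open>disk_sup_norm (dilatation f) < 1\<close>.
\<close>

definition d_aff :: "(complex \<Rightarrow> complex) \<Rightarrow> real" where
  "d_aff f =
     Sup {hyp_dist \<zeta> \<eta> | \<zeta> \<eta>. \<zeta> \<in> closure (dilatation f ` unit_disk) \<and>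
                               \<eta> \<in> closure (dilatation f ` unit_disk)}"

definition class_H :: "real \<Rightarrow> (complex \<Rightarrow> complex) set" where
  "class_H D = {f. sense_preserving_harmonic f \<and> disk_sup_norm (dilatation f) < 1 \<and> d_aff f \<le> D}"

definition class_S :: "real \<Rightarrow> (complex \<Rightarrow> complex) set" where
  "class_S D = {f \<in> class_H D. inj_on f unit_disk}"

definition op_affine_maps :: "(complex \<Rightarrow> complex) set" where
  "op_affine_maps = {A. \<exists>a b c. cmod a > cmod b \<and> A = (\<lambda>w. a * w + b * cnj w + c)}"

definition similarities :: "(complex \<Rightarrow> complex) set" where
  "similarities = {S. \<exists>l c. l \<noteq> 0 \<and> S = (\<lambda>w. l * w + c)}"

definition disk_automorphisms :: "(complex \<Rightarrow> complex) set" where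
  "disk_automorphisms = {\<phi>. \<phi> holomorphic_on unit_disk \<and> bij_betw \<phi> unit_disk unit_disk}"

definition locally_univalent :: "(complex \<Rightarrow> complex) \<Rightarrow> bool" where
  "locally_univalent \<phi> \<longleftrightarrow>
     (\<forall>z\<in>unit_disk. \<exists>U. open U \<and> z \<in> U \<and> U \<subseteq> unit_disk \<and> inj_on \<phi> U)"

text \<open>The Wirtinger derivative \<open>f\<^sub>z = (f\<^sub>x - \<i> f\<^sub>y) / 2\<close>.\<close>

definition wirtinger_z :: "(complex \<Rightarrow> complex) \<Rightarrow> complex \<Rightarrow> complex" where
  "wirtinger_z f z =
     (frechet_derivative f (at z) 1 - \<i> * frechet_derivative f (at z) \<i>) / 2"

definition koebe_normalization :: "(complex \<Rightarrow> complex) \<Rightarrow> complex \<Rightarrow> complex" where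
  "koebe_normalization f = (\<lambda>z. (f z - f 0) / wirtinger_z f 0)"

definition koebe_transform ::
  "(complex \<Rightarrow> complex) \<Rightarrow> (complex \<Rightarrow> complex) \<Rightarrow> complex \<Rightarrow> complex" where
  "koebe_transform \<phi> f = (\<lambda>z. (f (\<phi> z) - f (\<phi> 0)) / (wirtinger_z f (\<phi> 0) * deriv \<phi> 0))"

lemma harmonic_decomp_has_derivative:
  assumes "harmonic_decomp f h g" "z \<in> unit_disk"
  shows "(f has_derivative (\<lambda>v. deriv h z * v + cnj (deriv g z * v))) (at z)"
proof -
  have "(h has_derivative (*) (deriv h z)) (at z)" "(g has_derivative (*) (deriv g z)) (at z)"
    using assms unfolding harmonic_decomp_def
    by (auto intro!: has_field_derivative_imp_has_derivative holomorphic_derivI[of _ unit_disk])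
  then have "((\<lambda>w. h w + cnj (g w)) has_derivative
      (\<lambda>v. deriv h z * v + cnj (deriv g z * v))) (at z)"
    by (intro has_derivative_add has_derivative_cnj)
  then show ?thesis
    by (rule has_derivative_transform_within_open[of _ _ _ _ unit_disk])
       (use assms in \<open>auto simp: harmonic_decomp_def\<close>)
qed

lemma wirtinger_z_eq:
  assumes "harmonic_decomp f h g" "z \<in> unit_disk"
  shows "wirtinger_z f z = deriv h z"
  using frechet_derivative_at[OF harmonic_decomp_has_derivative[OF assms], symmetric]
  by (simp add: wirtinger_z_def algebra_simps)

lemma harmonic_decomp_deriv_unique:
  assumes "harmonic_decomp f h1 g1" "harmonic_decomp f h2 g2" "z \<in> unit_disk"
  shows "deriv h1 z = deriv h2 z" "deriv g1 z = deriv g2 z"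
proof -
  show h: "deriv h1 z = deriv h2 z"
    using wirtinger_z_eq assms by metis
  have "(\<lambda>v. deriv h1 z * v + cnj (deriv g1 z * v)) = (\<lambda>v. deriv h2 z * v + cnj (deriv g2 z * v))"
    using harmonic_decomp_has_derivative[OF assms(1,3)] harmonic_decomp_has_derivative[OF assms(2,3)]
    by (rule has_derivative_unique)
  from fun_cong[OF this, of 1] h show "deriv g1 z = deriv g2 z"
    by simp
qed

lemma dilatation_eq:
  assumes "harmonic_decomp f h g" "z \<in> unit_disk"
  shows "dilatation f z = deriv g z / deriv h z"
  unfolding dilatation_def
proof (rule the_equality)
  show "\<exists>h' g'. harmonic_decomp f h' g' \<and> deriv g z / deriv h z = deriv g' z / deriv h' z"
    using assms(1) by blast
next
  fix w
  assume "\<exists>h' g'. harmonic_decomp f h' g' \<and> w = deriv g' z / deriv h' z"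
  then obtain h' g' where d: "harmonic_decomp f h' g'" "w = deriv g' z / deriv h' z"
    by blast
  show "w = deriv g z / deriv h z"
    using harmonic_decomp_deriv_unique[OF d(1) assms] d(2) by simp
qed

end

theory Submission
  imports Defs "HOL-Complex_Analysis.Conformal_Mappings"
begin

text \<open>
  Postcomposition with an affine map \<open>w \<mapsto> a w + b cnj w + c\<close>, \<open>|a| > |b|\<close>, acts on the dilatation by
  the disk automorphism \<open>w \<mapsto> (cnj a w + cnj b) / (a + b w)\<close>, a hyperbolic isometry, while
  precomposition with an automorphism of the source leaves the image of the dilatation unchanged.
  Similarities and Koebe normalizations are special affine maps. If the affine distance is \<open>0\<close>, the
  dilatation is a constant \<open>w\<close>, so \<open>g = w h + const\<close> and \<open>f\<close> is an affine image of \<open>h\<close>.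
\<close>

section \<open>Disk Moebius maps attached to affine maps, and their isometry property\<close>

definition moebius_of_affine :: "complex \<Rightarrow> complex \<Rightarrow> complex \<Rightarrow> complex" where
  "moebius_of_affine a b w = (cnj a * w + cnj b) / (a + b * w)"

lemma moebius_denom_nonzero:
  assumes "cmod b < cmod a" "w \<in> unit_disk"
  shows "a + b * w \<noteq> 0"
proof
  assume "a + b * w = 0"
  then have "cmod a = cmod b * cmod w"
    by (metis add_eq_0_iff norm_minus_cancel norm_mult)
  also have "\<dots> \<le> cmod b * 1"
    using assms(2) by (intro mult_left_mono) auto
  finally show False using assms(1) by simp
qed

text \<open>Over a common denominator the terms symmetric in \<open>z\<close> and \<open>w\<close>
  cancel, which leaves the determinant \<open>a * cnj a - b * cnj b\<close> as a factor of
  \<open>z - w\<close>.\<close>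

lemma moebius_diff:
  assumes "cmod b < cmod a" "z \<in> unit_disk" "w \<in> unit_disk"
  shows "moebius_of_affine a b z - moebius_of_affine a b w =
    (a * cnj a - b * cnj b) * (z - w) / ((a + b * z) * (a + b * w))"
  using moebius_denom_nonzero[OF assms(1,2)] moebius_denom_nonzero[OF assms(1,3)]
  by (simp add: moebius_of_affine_def diff_frac_eq) (simp add: algebra_simps)

text \<open>Companion of \<open>moebius_diff\<close>: the same determinant appears, and the
  denominator differs only by one conjugation. In the quotient of the two identities, everything but
  the pseudo-hyperbolic quotient of \<open>z\<close> and \<open>w\<close> therefore cancels in
  modulus.\<close>

lemma moebius_one_minus:
  assumes "cmod b < cmod a" "z \<in> unit_disk" "w \<in> unit_disk"
  shows "1 - cnj (moebius_of_affine a b w) * moebius_of_affine a b z =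
    (a * cnj a - b * cnj b) * (1 - cnj w * z) / ((a + b * z) * cnj (a + b * w))"
proof -
  have "cnj (a + b * w) \<noteq> 0" "a + b * z \<noteq> 0"
    using moebius_denom_nonzero assms by (simp_all only: complex_cnj_zero_iff) auto
  then show ?thesis
    unfolding moebius_of_affine_def complex_cnj_divide times_divide_times_eq
    by (subst eq_divide_eq) (simp add: left_diff_distrib, simp add: algebra_simps)
qed

text \<open>The determinant is the Jacobian of the affine map. The \<open>of_real\<close> form links
  the complex identities above to positivity over the reals.\<close>

lemma affine_det_pos:
  assumes "cmod b < cmod a"
  shows "a * cnj a - b * cnj b = of_real ((cmod a)\<^sup>2 - (cmod b)\<^sup>2)" "(cmod a)\<^sup>2 - (cmod b)\<^sup>2 > 0"
  using assms
  by (simp_all only: of_real_diff complex_norm_square diff_gt_0_iff_gt)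
     (simp add: power_strict_mono)

text \<open>The diagonal case of \<open>moebius_one_minus\<close> writes one minus the squared
  modulus of the image as a quotient of positive reals.\<close>

lemma moebius_in_disk:
  assumes "cmod b < cmod a" "w \<in> unit_disk"
  shows "moebius_of_affine a b w \<in> unit_disk"
proof -
  let ?m = "moebius_of_affine a b w"
  have "complex_of_real (1 - (cmod ?m)\<^sup>2) = 1 - cnj ?m * ?m"
    by (simp add: complex_norm_square mult.commute del: of_real_power)
  also have "\<dots> = of_real (((cmod a)\<^sup>2 - (cmod b)\<^sup>2) * (1 - (cmod w)\<^sup>2) / (cmod (a + b * w))\<^sup>2)"
    unfolding moebius_one_minus[OF assms(1,2,2)] affine_det_pos(1)[OF assms(1)]
    by (simp add: complex_norm_square mult.commute del: of_real_power)
  finally have "1 - (cmod ?m)\<^sup>2 = ((cmod a)\<^sup>2 - (cmod b)\<^sup>2) * (1 - (cmod w)\<^sup>2) / (cmod (a + b * w))\<^sup>2"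
    by (simp only: of_real_eq_iff)
  also have "\<dots> > 0"
    using affine_det_pos(2)[OF assms(1)] moebius_denom_nonzero[OF assms] assms(2)
    by (intro divide_pos_pos mult_pos_pos) (auto simp: power_less_one_iff abs_square_less_1)
  finally show ?thesis by (simp add: abs_square_less_1)
qed

lemma hyp_dist_moebius:
  assumes "cmod b < cmod a" "z \<in> unit_disk" "w \<in> unit_disk"
  shows "hyp_dist (moebius_of_affine a b z) (moebius_of_affine a b w) = hyp_dist z w"
proof -
  have n: "cmod (a + b * z) \<noteq> 0" "cmod (a + b * w) \<noteq> 0"
      "cmod (a * cnj a - b * cnj b) \<noteq> 0"
    using moebius_denom_nonzero[OF assms(1)] assms(2,3) affine_det_pos[OF assms(1)]
    by (auto simp del: of_real_diff of_real_power)
  show ?thesis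
    unfolding hyp_dist_def moebius_diff[OF assms] moebius_one_minus[OF assms]
      norm_divide norm_mult complex_mod_cnj
    using n by (simp add: field_simps)
qed

section \<open>Compact sets of dilatation values and membership in \<open>class_H\<close>\<close>

lemma closure_image_compact_closure:
  fixes f :: "'a::heine_borel \<Rightarrow> 'b::t2_space"
  assumes "bounded X" "continuous_on (closure X) f"
  shows "closure (f ` X) = f ` closure X"
proof (rule antisym)
  \<comment> \<open>Compactness makes this image closed, so it already contains the closure of the
    smaller image.\<close>
  have "compact (f ` closure X)"
    using assms by (intro compact_continuous_image) (auto simp: compact_closure)
  then show "closure (f ` X) \<subseteq> f ` closure X"
    by (intro closure_minimal compact_imp_closed image_mono closure_subset)
  show "f ` closure X \<subseteq> closure (f ` X)"
    using assms(2) by (intro image_closure_subset closure_subset) auto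
qed

text \<open>The largest modulus is attained at a point of the open disk, hence is strictly below 1.
  This turns containment of a closure into a uniform bound.\<close>

lemma compact_in_disk_bound:
  assumes "compact K" "K \<subseteq> unit_disk" "K \<noteq> {}"
  obtains r where "r < 1" "\<And>w. w \<in> K \<Longrightarrow> cmod w \<le> r"
proof -
  obtain x where "x \<in> K" "\<And>w. w \<in> K \<Longrightarrow> cmod w \<le> cmod x"
    using continuous_attains_sup[OF assms(1,3), of cmod] continuous_on_norm_id by blast
  with assms(2) that[of "cmod x"] show ?thesis by auto
qed

lemma one_minus_cnj_mult_nonzero:
  assumes "z \<in> unit_disk" "w \<in> unit_disk"
  shows "1 - cnj w * z \<noteq> 0"
  using moebius_denom_nonzero[of "- cnj w" 1 z] assms by simp

text \<open>With \<open>a = 1\<close> and \<open>b = - cnj w\<close>, the value of the Moebius map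
  at \<open>z\<close> is exactly this quotient.\<close>

lemma pseudo_hyperbolic_less_one:
  assumes "z \<in> unit_disk" "w \<in> unit_disk"
  shows "cmod ((z - w) / (1 - cnj w * z)) < 1"
  using moebius_in_disk[of "- cnj w" 1 z] assms by (simp add: moebius_of_affine_def)

text \<open>The distance is continuous on the compact square of \<open>K\<close>. The bound is what
  allows single distances to be compared with the real \<open>Sup\<close> in
  \<open>d_aff\<close>.\<close>

lemma hyp_dist_bdd_above:
  assumes "compact K" "K \<subseteq> unit_disk"
  shows "bdd_above {hyp_dist \<zeta> \<eta> | \<zeta> \<eta>. \<zeta> \<in> K \<and> \<eta> \<in> K}"
proof -
  \<comment> \<open>\<open>artanh\<close> is continuous only on the open interval from -1 to 1, so
    the strict bound on the pseudo-hyperbolic quotient is essential here.\<close>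
  have "continuous_on (K \<times> K) (\<lambda>p. artanh (cmod ((fst p - snd p) / (1 - cnj (snd p) * fst p))))"
  proof (rule continuous_on_compose2[OF continuous_on_artanh[OF order.refl]])
    show "continuous_on (K \<times> K) (\<lambda>p. cmod ((fst p - snd p) / (1 - cnj (snd p) * fst p)))"
      using assms(2) by (intro continuous_intros ballI one_minus_cnj_mult_nonzero) auto
    show "(\<lambda>p. cmod ((fst p - snd p) / (1 - cnj (snd p) * fst p))) ` (K \<times> K) \<subseteq> {-1<..<1}"
    proof (rule image_subsetI)
      fix p assume "p \<in> K \<times> K"
      then have "fst p \<in> unit_disk" "snd p \<in> unit_disk" using assms(2) by auto
      then show "cmod ((fst p - snd p) / (1 - cnj (snd p) * fst p)) \<in> {-1<..<1}"
        using pseudo_hyperbolic_less_one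
        by (simp add: less_le_trans[OF _ norm_ge_zero] del: norm_divide)
    qed
  qed
  then have c: "continuous_on (K \<times> K) (\<lambda>p. hyp_dist (fst p) (snd p))"
    unfolding hyp_dist_def by (intro continuous_intros)
  have "{hyp_dist \<zeta> \<eta> | \<zeta> \<eta>. \<zeta> \<in> K \<and> \<eta> \<in> K} = (\<lambda>p. hyp_dist (fst p) (snd p)) ` (K \<times> K)"
    by force
  then show ?thesis
    using compact_continuous_image[OF c compact_Times[OF assms(1,1)]]
    by (simp add: bounded_imp_bdd_above compact_imp_bounded)
qed

text \<open>Distinct points give a quotient strictly between 0 and 1, where the logarithm defining
  \<open>artanh\<close> has an argument above 1.\<close>

lemma hyp_dist_le_0_imp_eq:
  assumes "z \<in> unit_disk" "w \<in> unit_disk" "hyp_dist z w \<le> 0"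
  shows "z = w"
proof (rule ccontr)
  assume "z \<noteq> w"
  let ?q = "cmod ((z - w) / (1 - cnj w * z))"
  have q: "?q > 0" using \<open>z \<noteq> w\<close> one_minus_cnj_mult_nonzero[OF assms(1,2)] by simp
  have "?q < 1" by (rule pseudo_hyperbolic_less_one[OF assms(1,2)])
  then have "(1 + ?q) / (1 - ?q) > 1" using q by (simp add: less_divide_eq)
  then have "artanh ?q > 0" unfolding artanh_def by simp
  with assms(3) show False by (simp add: hyp_dist_def)
qed

text \<open>A working form for the invariance proofs: the Jacobian condition and the norm bound
  merge into one condition on the closed range of the dilatation. Nonvanishing of
  \<open>deriv h\<close> stays explicit, since division by zero yields 0 and the dilatation alone
  would not detect a zero of \<open>deriv h\<close>.\<close>

lemma mem_class_H_iff:
  "f \<in> class_H D \<longleftrightarrow>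
     (\<exists>h g. harmonic_decomp f h g \<and> (\<forall>z\<in>unit_disk. deriv h z \<noteq> 0)) \<and>
     closure (dilatation f ` unit_disk) \<subseteq> unit_disk \<and> d_aff f \<le> D" (is "?L \<longleftrightarrow> ?R")
proof
  assume L: ?L
  then obtain h g where hg: "harmonic_decomp f h g"
      and J: "\<And>z. z \<in> unit_disk \<Longrightarrow> (cmod (deriv h z))\<^sup>2 - (cmod (deriv g z))\<^sup>2 > 0"
    unfolding class_H_def sense_preserving_harmonic_def by blast
  have nz: "deriv h z \<noteq> 0" if "z \<in> unit_disk" for z
    using J[OF that] by auto
  have lt1: "cmod (dilatation f z) < 1" if "z \<in> unit_disk" for z
  proof -
    have "cmod (deriv g z) < cmod (deriv h z)"
      using J[OF that] by (simp add: power2_less_imp_less)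
    then show ?thesis
      using nz[OF that] by (simp add: dilatation_eq[OF hg that] norm_divide)
  qed
  \<comment> \<open>A real \<open>SUP\<close> dominates its members only for a bounded family;
    \<open>lt1\<close> provides the bound 1.\<close>
  have "cmod (dilatation f z) \<le> disk_sup_norm (dilatation f)" if "z \<in> unit_disk" for z
    unfolding disk_sup_norm_def
    using that less_imp_le[OF lt1] by (intro cSUP_upper bdd_aboveI2[where M = 1])
  then have "closure (dilatation f ` unit_disk) \<subseteq> cball 0 (disk_sup_norm (dilatation f))"
    by (intro closure_minimal) auto
  also have "\<dots> \<subseteq> unit_disk"
    using L by (auto simp: class_H_def)
  finally show ?R
    using hg nz L by (auto simp: class_H_def)
next
  assume R: ?R
  then obtain h g where hg: "harmonic_decomp f h g"
      and nz: "\<And>z. z \<in> unit_disk \<Longrightarrow> deriv h z \<noteq> 0"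
    by blast
  let ?K = "closure (dilatation f ` unit_disk)"
  have K: "?K \<subseteq> unit_disk" using R by blast
  then have "compact ?K"
    by (meson bounded_ball bounded_subset closed_closure compact_eq_bounded_closed)
  then obtain r where r: "r < 1" "\<And>w. w \<in> ?K \<Longrightarrow> cmod w \<le> r"
    using compact_in_disk_bound[of ?K] K by auto
  have le: "cmod (dilatation f z) \<le> r" if "z \<in> unit_disk" for z
    using that by (intro r(2) set_mp[OF closure_subset]) auto
  have "disk_sup_norm (dilatation f) \<le> r"
    unfolding disk_sup_norm_def by (intro cSUP_least le) auto
  moreover have "(cmod (deriv h z))\<^sup>2 - (cmod (deriv g z))\<^sup>2 > 0" if "z \<in> unit_disk" for z
  proof -
    have "cmod (deriv g z) < cmod (deriv h z)"
      using le_less_trans[OF le[OF that] r(1)] nz[OF that]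
      by (simp add: dilatation_eq[OF hg that] norm_divide)
    then show ?thesis by (simp add: power_strict_mono)
  qed
  then have "sense_preserving_harmonic f"
    using hg unfolding sense_preserving_harmonic_def by blast
  ultimately show ?L
    using R r(1) by (simp add: class_H_def)
qed

section \<open>Invariance under affine postcomposition and source automorphisms\<close>

lemma harmonic_decomp_affine:
  assumes "harmonic_decomp f h g"
  shows "harmonic_decomp ((\<lambda>w. a * w + b * cnj w + c) \<circ> f)
    (\<lambda>z. a * h z + b * g z + c) (\<lambda>z. cnj a * g z + cnj b * h z)"
  using assms unfolding harmonic_decomp_def
  by (auto intro!: holomorphic_intros simp: algebra_simps)

lemma class_H_affine:
  assumes f: "f \<in> class_H D" and A: "A \<in> op_affine_maps"
  shows "A \<circ> f \<in> class_H D"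
proof -
  obtain a b c where ab: "cmod b < cmod a" and A_eq: "A = (\<lambda>w. a * w + b * cnj w + c)"
    using A by (auto simp: op_affine_maps_def)
  obtain h g where hg: "harmonic_decomp f h g"
      and nz: "\<And>z. z \<in> unit_disk \<Longrightarrow> deriv h z \<noteq> 0"
      and K: "closure (dilatation f ` unit_disk) \<subseteq> unit_disk"
    using f unfolding mem_class_H_iff by blast
  let ?K = "closure (dilatation f ` unit_disk)" and ?T = "moebius_of_affine a b"
  \<comment> \<open>As \<open>cnj f = cnj h + g\<close> on the disk, conjugation swaps the roles of
    the two parts; the constant is put into the analytic one.\<close>
  define H where "H = (\<lambda>z. a * h z + b * g z + c)"
  define G where "G = (\<lambda>z. cnj a * g z + cnj b * h z)"
  have HG: "harmonic_decomp (A \<circ> f) H G"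
    unfolding A_eq H_def G_def by (rule harmonic_decomp_affine[OF hg])
  have dil_in: "dilatation f z \<in> unit_disk" if "z \<in> unit_disk" for z
    using K closure_subset that by (meson image_eqI subsetD)
  have d: "deriv H z = deriv h z * (a + b * dilatation f z)"
          "deriv G z = deriv h z * (cnj a * dilatation f z + cnj b)" if z: "z \<in> unit_disk" for z
  proof -
    have "(h has_field_derivative deriv h z) (at z)" "(g has_field_derivative deriv g z) (at z)"
      using hg z unfolding harmonic_decomp_def by (auto intro!: holomorphic_derivI[of _ unit_disk])
    then have "deriv H z = a * deriv h z + b * deriv g z"
        "deriv G z = cnj a * deriv g z + cnj b * deriv h z"
      unfolding H_def G_def by (auto intro!: DERIV_imp_deriv derivative_eq_intros)
    then show "deriv H z = deriv h z * (a + b * dilatation f z)"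
          "deriv G z = deriv h z * (cnj a * dilatation f z + cnj b)"
      using nz[OF z] by (simp_all add: dilatation_eq[OF hg z] algebra_simps)
  qed
  have dil: "dilatation (A \<circ> f) z = ?T (dilatation f z)" if "z \<in> unit_disk" for z
    using d[OF that] nz[OF that] by (simp add: dilatation_eq[OF HG that] moebius_of_affine_def)
  have "continuous_on ?K ?T"
    unfolding moebius_of_affine_def using K moebius_denom_nonzero[OF ab]
    by (intro continuous_intros) blast
  moreover have "bounded (dilatation f ` unit_disk)"
    using K closure_subset bounded_ball bounded_subset by metis
  \<comment> \<open>\<open>d_aff\<close> sees the closure of the range, so the Moebius map has to
    commute with taking closures; continuity on the compact set \<open>?K\<close> ensures
    this.\<close>
  ultimately have cl: "closure (dilatation (A \<circ> f) ` unit_disk) = ?T ` ?K"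
    using closure_image_compact_closure[of "dilatation f ` unit_disk" ?T]
    by (simp only: image_image dil cong: image_cong)
  \<comment> \<open>The isometry identifies the sets of distances themselves, so their suprema agree
    by rewriting.\<close>
  have "{hyp_dist \<zeta> \<eta> | \<zeta> \<eta>. \<zeta> \<in> ?T ` ?K \<and> \<eta> \<in> ?T ` ?K} = {hyp_dist \<zeta> \<eta> | \<zeta> \<eta>. \<zeta> \<in> ?K \<and> \<eta> \<in> ?K}"
    (is "?X = ?Y")
  proof -
    have inv: "hyp_dist (?T \<zeta>) (?T \<eta>) = hyp_dist \<zeta> \<eta>" if "\<zeta> \<in> ?K" "\<eta> \<in> ?K" for \<zeta> \<eta>
      using that K by (intro hyp_dist_moebius[OF ab]) auto
    show "?X = ?Y"
    proof (intro set_eqI iffI)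
      fix x assume "x \<in> ?X"
      then show "x \<in> ?Y" using inv by auto
    next
      fix x assume "x \<in> ?Y"
      then obtain \<zeta> \<eta> where "\<zeta> \<in> ?K" "\<eta> \<in> ?K" "x = hyp_dist (?T \<zeta>) (?T \<eta>)"
        using inv by auto
      then show "x \<in> ?X" by blast
    qed
  qed
  then have "d_aff (A \<circ> f) = d_aff f"
    unfolding d_aff_def cl by simp
  moreover have "?T ` ?K \<subseteq> unit_disk"
    using K moebius_in_disk[OF ab] by blast
  moreover have "deriv H z \<noteq> 0" if "z \<in> unit_disk" for z
    using d(1)[OF that] nz[OF that] moebius_denom_nonzero[OF ab dil_in[OF that]] by simp
  ultimately show ?thesis
    using f HG unfolding mem_class_H_iff cl by auto
qed

text \<open>The chain rule multiplies both derivatives by \<open>deriv \<phi> z\<close>, which is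
  nonzero by injectivity and cancels in the dilatation. Surjectivity then gives the same range of
  dilatation values.\<close>

lemma class_H_automorphism:
  assumes f: "f \<in> class_H D" and phi: "\<phi> \<in> disk_automorphisms"
  shows "f \<circ> \<phi> \<in> class_H D"
proof -
  have hol: "\<phi> holomorphic_on unit_disk" and bij: "bij_betw \<phi> unit_disk unit_disk"
    using phi by (auto simp: disk_automorphisms_def)
  have im: "\<phi> ` unit_disk = unit_disk" using bij by (rule bij_betw_imp_surj_on)
  have nz_phi: "deriv \<phi> z \<noteq> 0" if "z \<in> unit_disk" for z
    using holomorphic_injective_imp_regular[OF hol _ bij_betw_imp_inj_on[OF bij] that] by simp
  obtain h g where hg: "harmonic_decomp f h g"
      and nz: "\<And>z. z \<in> unit_disk \<Longrightarrow> deriv h z \<noteq> 0"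
    using f unfolding mem_class_H_iff by blast
  have holhg: "h holomorphic_on unit_disk" "g holomorphic_on unit_disk"
    using hg by (auto simp: harmonic_decomp_def)
  have HG: "harmonic_decomp (f \<circ> \<phi>) (h \<circ> \<phi>) (g \<circ> \<phi>)"
    unfolding harmonic_decomp_def
  proof (intro conjI ballI)
    show "h \<circ> \<phi> holomorphic_on unit_disk" "g \<circ> \<phi> holomorphic_on unit_disk"
      by (rule holomorphic_on_compose_gen[OF hol], use holhg im in auto)+
    show "(f \<circ> \<phi>) z = (h \<circ> \<phi>) z + cnj ((g \<circ> \<phi>) z)" if "z \<in> unit_disk" for z
      using hg im that by (auto simp: harmonic_decomp_def)
  qed
  have d: "deriv (k \<circ> \<phi>) z = deriv k (\<phi> z) * deriv \<phi> z"
    if "k holomorphic_on unit_disk" "z \<in> unit_disk" for k z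
    using that hol im
    by (intro deriv_chain) (auto intro!: holomorphic_on_imp_differentiable_at[of _ unit_disk])
  have "dilatation (f \<circ> \<phi>) z = dilatation f (\<phi> z)" if "z \<in> unit_disk" for z
  proof -
    have "\<phi> z \<in> unit_disk" using im that by blast
    then show ?thesis
      using dilatation_eq[OF HG that] dilatation_eq[OF hg] that nz_phi[OF that]
      by (simp add: d holhg)
  qed
  then have dil_im: "dilatation (f \<circ> \<phi>) ` unit_disk = dilatation f ` unit_disk"
    using im by (metis (no_types, lifting) image_cong image_image)
  then have "d_aff (f \<circ> \<phi>) = d_aff f" by (simp add: d_aff_def)
  moreover have "deriv (h \<circ> \<phi>) z \<noteq> 0" if "z \<in> unit_disk" for z
  proof -
    have "\<phi> z \<in> unit_disk" using im that by blast
    then show ?thesis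
      using nz nz_phi[OF that] d[OF holhg(1) that] by simp
  qed
  ultimately show ?thesis
    using f HG dil_im unfolding mem_class_H_iff by auto
qed

section \<open>Bijectivity of affine maps, univalent classes and Koebe transforms\<close>

lemma op_affine_inj:
  assumes "A \<in> op_affine_maps"
  shows "inj A"
proof (rule injI)
  obtain a b c where ab: "cmod b < cmod a" and A_eq: "A = (\<lambda>w. a * w + b * cnj w + c)"
    using assms by (auto simp: op_affine_maps_def)
  fix x y assume "A x = A y"
  then have "a * (x - y) = - (b * cnj (x - y))"
    by (simp add: A_eq algebra_simps)
  then have "cmod a * cmod (x - y) = cmod b * cmod (x - y)"
    by (metis complex_mod_cnj norm_minus_cancel norm_mult)
  with ab show "x = y" by simp
qed

lemma op_affine_surj:
  assumes "A \<in> op_affine_maps"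
  shows "surj A"
proof -
  obtain a b c where ab: "cmod b < cmod a" and A_eq: "A = (\<lambda>w. a * w + b * cnj w + c)"
    using assms by (auto simp: op_affine_maps_def)
  \<comment> \<open>The preimage comes from Cramer's rule for the equation
    \<open>a * u + b * cnj u = w - c\<close> together with its conjugate.\<close>
  have "A ((cnj a * (w - c) - b * cnj (w - c)) / (a * cnj a - b * cnj b)) = w" for w
  proof -
    let ?d = "a * cnj a - b * cnj b"
    have "?d \<noteq> 0" using affine_det_pos[OF ab] by (metis less_irrefl of_real_eq_0_iff)
    moreover have "cnj ?d = ?d" by (simp add: mult.commute)
    moreover have "a * (cnj a * (w - c) - b * cnj (w - c)) + b * cnj (cnj a * (w - c) - b * cnj (w - c))
        = ?d * (w - c)"
      by (simp add: algebra_simps)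
    ultimately show ?thesis
      by (simp only: A_eq complex_cnj_divide times_divide_eq_right flip: add_divide_distrib) simp
  qed
  then show ?thesis by (rule surjI)
qed

lemma class_S_affine:
  assumes "f \<in> class_S D" "A \<in> op_affine_maps"
  shows "A \<circ> f \<in> class_S D"
  using assms class_H_affine inj_on_subset[OF op_affine_inj[OF assms(2)] subset_UNIV]
  by (auto simp: class_S_def intro!: comp_inj_on)

lemma class_S_automorphism:
  assumes "f \<in> class_S D" "\<phi> \<in> disk_automorphisms"
  shows "f \<circ> \<phi> \<in> class_S D"
  using assms class_H_automorphism
  by (auto simp: class_S_def disk_automorphisms_def bij_betw_def intro!: comp_inj_on)

lemma similarities_subset_op_affine: "similarities \<subseteq> op_affine_maps"
  unfolding similarities_def op_affine_maps_def by (force intro: exI[of _ 0])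

lemma wirtinger_z_nonzero:
  assumes "f \<in> class_H D" "z \<in> unit_disk"
  shows "wirtinger_z f z \<noteq> 0"
  using assms wirtinger_z_eq unfolding mem_class_H_iff by metis

lemma divided_difference_similarity:
  assumes "l \<noteq> 0"
  shows "(\<lambda>w. (w - c) / l) \<in> similarities"
  unfolding similarities_def mem_Collect_eq using assms
  by (intro exI[of _ "1 / l"] exI[of _ "- (c / l)"]) (auto simp: diff_divide_distrib)

text \<open>Both denominator factors are nonzero: the Wirtinger derivative equals
  \<open>deriv h\<close>, and an injective holomorphic map has nonvanishing derivative. The
  transform is then a similarity applied to \<open>f \<circ> \<phi>\<close>, which reduces it to the
  two invariances already shown.\<close>

lemma koebe_transform_eq_affine:
  assumes f: "f \<in> class_H D" and phi: "\<phi> \<in> disk_automorphisms"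
  obtains A where "A \<in> op_affine_maps" "koebe_transform \<phi> f = A \<circ> (f \<circ> \<phi>)"
proof -
  have hol: "\<phi> holomorphic_on unit_disk" and bij: "bij_betw \<phi> unit_disk unit_disk"
    using phi by (auto simp: disk_automorphisms_def)
  have "deriv \<phi> 0 \<noteq> 0"
    using holomorphic_injective_imp_regular[OF hol _ bij_betw_imp_inj_on[OF bij], of 0] by simp
  moreover have "wirtinger_z f (\<phi> 0) \<noteq> 0"
    using wirtinger_z_nonzero[OF f] bij_betwE[OF bij] by simp
  ultimately have "(\<lambda>w. (w - f (\<phi> 0)) / (wirtinger_z f (\<phi> 0) * deriv \<phi> 0)) \<in> op_affine_maps"
    using divided_difference_similarity similarities_subset_op_affine by auto
  then show ?thesis
    by (rule that) (simp add: koebe_transform_def comp_def)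
qed

lemma koebe_normalization_eq_transform: "koebe_normalization f = koebe_transform id f"
  by (simp add: koebe_normalization_def koebe_transform_def)

lemma id_disk_automorphism: "id \<in> disk_automorphisms"
  by (simp add: disk_automorphisms_def holomorphic_on_id)

section \<open>The classes of affine distance zero\<close>

lemma locally_univalent_iff_deriv_nonzero:
  assumes "\<phi> holomorphic_on unit_disk"
  shows "locally_univalent \<phi> \<longleftrightarrow> (\<forall>z\<in>unit_disk. deriv \<phi> z \<noteq> 0)"
proof
  assume "locally_univalent \<phi>"
  then show "\<forall>z\<in>unit_disk. deriv \<phi> z \<noteq> 0"
    unfolding locally_univalent_def
    by (meson assms holomorphic_injective_imp_regular holomorphic_on_subset)
next
  assume nz: "\<forall>z\<in>unit_disk. deriv \<phi> z \<noteq> 0"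
  show "locally_univalent \<phi>"
    unfolding locally_univalent_def
  proof
    fix z :: complex assume z: "z \<in> unit_disk"
    with nz obtain r where "r > 0" "ball z r \<subseteq> unit_disk" "inj_on \<phi> (ball z r)"
      using has_complex_derivative_locally_injective[OF assms z] by auto
    then show "\<exists>U. open U \<and> z \<in> U \<and> U \<subseteq> unit_disk \<and> inj_on \<phi> U"
      by (intro exI[of _ "ball z r"]) auto
  qed
qed

text \<open>The anti-analytic part can be taken to be 0, so the dilatation takes the single value
  0.\<close>

lemma locally_univalent_in_class_H_0:
  assumes "\<phi> holomorphic_on unit_disk" "locally_univalent \<phi>"
  shows "\<phi> \<in> class_H 0"
proof -
  have hg: "harmonic_decomp \<phi> \<phi> (\<lambda>_. 0)"
    using assms(1) by (auto simp: harmonic_decomp_def)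
  have "dilatation \<phi> ` unit_disk = (\<lambda>_. 0) ` unit_disk"
    by (rule image_cong) (auto simp: dilatation_eq[OF hg])
  then have "dilatation \<phi> ` unit_disk = {0}" by (simp add: image_constant_conv)
  then show ?thesis
    using hg assms locally_univalent_iff_deriv_nonzero
    by (auto simp: mem_class_H_iff d_aff_def hyp_dist_def)
qed

lemma class_H_0_imp_constant_dilatation:
  assumes "f \<in> class_H 0"
  obtains w where "w \<in> unit_disk" "\<And>z. z \<in> unit_disk \<Longrightarrow> dilatation f z = w"
proof (rule that[of "dilatation f 0"])
  let ?K = "closure (dilatation f ` unit_disk)"
  have K: "?K \<subseteq> unit_disk" and d: "d_aff f \<le> 0" using assms by (auto simp: mem_class_H_iff)
  have in_K: "dilatation f z \<in> ?K" if "z \<in> unit_disk" for z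
    by (rule subsetD[OF closure_subset imageI[OF that]])
  have K0: "dilatation f 0 \<in> ?K" by (rule in_K) simp
  show "dilatation f 0 \<in> unit_disk" using K K0 by (rule subsetD)
  have "compact ?K"
    using K by (meson bounded_ball bounded_subset closed_closure compact_eq_bounded_closed)
  \<comment> \<open>Boundedness is needed before \<open>d_aff f \<le> 0\<close> says anything about
    individual distances.\<close>
  note bdd = hyp_dist_bdd_above[OF this K]
  fix z :: complex assume z: "z \<in> unit_disk"
  have "hyp_dist (dilatation f z) (dilatation f 0) \<le> d_aff f"
    unfolding d_aff_def using in_K[OF z] K0 by (intro cSup_upper bdd) blast
  then show "dilatation f z = dilatation f 0"
    using d subsetD[OF K in_K[OF z]] subsetD[OF K K0] by (intro hyp_dist_le_0_imp_eq) auto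
qed

lemma class_H_0_imp_affine_image:
  assumes "f \<in> class_H 0"
  obtains A \<phi> where "A \<in> op_affine_maps" "\<phi> holomorphic_on unit_disk" "locally_univalent \<phi>"
    "f = A \<circ> \<phi>"
proof -
  obtain h g where hg: "harmonic_decomp f h g"
      and nz: "\<And>z. z \<in> unit_disk \<Longrightarrow> deriv h z \<noteq> 0"
    using assms unfolding mem_class_H_iff by blast
  have hol: "h holomorphic_on unit_disk" "g holomorphic_on unit_disk"
    using hg by (auto simp: harmonic_decomp_def)
  obtain w where w: "w \<in> unit_disk" "\<And>z. z \<in> unit_disk \<Longrightarrow> dilatation f z = w"
    using class_H_0_imp_constant_dilatation[OF assms] by blast
  \<comment> \<open>Constant dilatation means \<open>deriv g = w * deriv h\<close>; convexity of the
    disk allows integration.\<close>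
  have "\<exists>c. \<forall>z\<in>unit_disk. g z - w * h z = c"
  proof (rule has_field_derivative_zero_constant)
    fix z :: complex assume z: "z \<in> unit_disk"
    have "((\<lambda>z. g z - w * h z) has_field_derivative deriv g z - w * deriv h z) (at z)"
      using hol z by (auto intro!: derivative_eq_intros holomorphic_derivI[of _ unit_disk])
    moreover have "deriv g z - w * deriv h z = 0"
      using w(2)[OF z] dilatation_eq[OF hg z] nz[OF z] by (simp add: field_simps)
    ultimately show "((\<lambda>z. g z - w * h z) has_field_derivative 0) (at z within unit_disk)"
      by (simp add: has_field_derivative_at_within)
  qed auto
  then obtain c where c: "\<And>z. z \<in> unit_disk \<Longrightarrow> g z = w * h z + c"
    by (metis add.commute diff_add_cancel)
  \<comment> \<open>Substituting \<open>g = w * h + c\<close> into \<open>h + cnj g\<close>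
    conjugates both \<open>w\<close> and \<open>c\<close>. Orientation is preserved because
    \<open>w\<close> lies in the open disk.\<close>
  define A where "A = (\<lambda>u. 1 * u + cnj w * cnj u + cnj c)"
  have A: "A \<in> op_affine_maps"
    unfolding A_def op_affine_maps_def mem_Collect_eq using w(1)
    by (intro exI[of _ 1] exI[of _ "cnj w"] exI[of _ "cnj c"]) simp
  define \<phi> where "\<phi> = inv A \<circ> f"
  \<comment> \<open>\<open>f = A \<circ> h\<close> holds only on the disk, \<open>f = A \<circ> \<phi>\<close> everywhere.\<close>
  have f_eq: "f = A \<circ> \<phi>"
    using surj_f_inv_f[OF op_affine_surj[OF A]] by (auto simp: \<phi>_def)
  have phi_eq: "\<phi> z = h z" if "z \<in> unit_disk" for z
  proof -
    have "f z = A (h z)"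
      using hg that c[OF that] by (simp add: harmonic_decomp_def A_def)
    then show ?thesis
      using op_affine_inj[OF A] by (simp add: \<phi>_def)
  qed
  have "\<phi> holomorphic_on unit_disk"
    using holomorphic_transform[OF hol(1)] phi_eq by metis
  moreover have "locally_univalent \<phi>"
  proof -
    have "inj_on \<phi> U \<longleftrightarrow> inj_on h U" if "U \<subseteq> unit_disk" for U
      using that phi_eq by (intro inj_on_cong) auto
    moreover have "locally_univalent h"
      using locally_univalent_iff_deriv_nonzero[OF hol(1)] nz by blast
    ultimately show ?thesis
      unfolding locally_univalent_def by meson
  qed
  ultimately show ?thesis using that A f_eq by blast
qed

theorem proposition7p3:
  shows "(\<forall>D::real. D \<ge> 0 \<longrightarrow>
            (\<forall>C \<in> {class_H D, class_S D}. \<forall>f \<in> C.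
               (\<forall>A \<in> op_affine_maps. A \<circ> f \<in> C) \<and>
               (\<forall>\<phi> \<in> disk_automorphisms. f \<circ> \<phi> \<in> C) \<and>
               (\<forall>S \<in> similarities. S \<circ> f \<in> C) \<and>
               koebe_normalization f \<in> C \<and>
               (\<forall>\<phi> \<in> disk_automorphisms. koebe_transform \<phi> f \<in> C))) \<and>
         class_H 0 = {A \<circ> \<phi> | A \<phi>. A \<in> op_affine_maps \<and>
                        \<phi> holomorphic_on unit_disk \<and> locally_univalent \<phi>} \<and>
         class_S 0 = {A \<circ> \<phi> | A \<phi>. A \<in> op_affine_maps \<and>
                        \<phi> holomorphic_on unit_disk \<and> inj_on \<phi> unit_disk}"
proof (intro conjI allI impI ballI)
  fix D :: real and C f
  assume C: "C \<in> {class_H D, class_S D}" and f: "f \<in> C"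
  have fH: "f \<in> class_H D" using C f by (auto simp: class_S_def)
  \<comment> \<open>Stated for every \<open>k\<close> in \<open>C\<close>, because the Koebe
    transform needs it for \<open>f \<circ> \<phi>\<close>.\<close>
  have affine: "A \<circ> k \<in> C" if "k \<in> C" "A \<in> op_affine_maps" for A k
    using C that class_H_affine class_S_affine by blast
  have aut: "f \<circ> \<phi> \<in> C" if "\<phi> \<in> disk_automorphisms" for \<phi>
    using C f that class_H_automorphism class_S_automorphism by blast
  have koebe: "koebe_transform \<phi> f \<in> C" if "\<phi> \<in> disk_automorphisms" for \<phi>
    using koebe_transform_eq_affine[OF fH that] affine aut[OF that] by metis
  show "A \<circ> f \<in> C" if "A \<in> op_affine_maps" for A
    using f that by (rule affine)
  show "f \<circ> \<phi> \<in> C" if "\<phi> \<in> disk_automorphisms" for \<phi>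
    using that by (rule aut)
  show "S \<circ> f \<in> C" if "S \<in> similarities" for S
    using affine f similarities_subset_op_affine that by blast
  show "koebe_normalization f \<in> C"
    unfolding koebe_normalization_eq_transform by (rule koebe[OF id_disk_automorphism])
  show "koebe_transform \<phi> f \<in> C" if "\<phi> \<in> disk_automorphisms" for \<phi>
    using that by (rule koebe)
next
  show H0: "class_H 0 = {A \<circ> \<phi> | A \<phi>. A \<in> op_affine_maps \<and>
                        \<phi> holomorphic_on unit_disk \<and> locally_univalent \<phi>}" (is "_ = ?R")
  proof (intro set_eqI iffI)
    fix f assume "f \<in> class_H 0"
    then show "f \<in> ?R" using class_H_0_imp_affine_image[of f] by blast
  next
    fix f assume "f \<in> ?R"
    then show "f \<in> class_H 0" using class_H_affine locally_univalent_in_class_H_0 by blast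
  qed
  \<comment> \<open>Univalence passes both ways through an injective affine map. Together with
    \<open>univalent\<close>, this restricts the description of \<open>class_H 0\<close> to the
    univalent case.\<close>
  have inj_comp: "inj_on (A \<circ> \<phi>) unit_disk \<longleftrightarrow> inj_on \<phi> unit_disk"
    if "A \<in> op_affine_maps" for A and \<phi> :: "complex \<Rightarrow> complex"
    using op_affine_inj[OF that] by (auto simp: inj_on_def)
  have univalent: "locally_univalent \<phi>" if "inj_on \<phi> unit_disk" for \<phi>
    unfolding locally_univalent_def using that by (auto intro!: exI[of _ unit_disk])
  show "class_S 0 = {A \<circ> \<phi> | A \<phi>. A \<in> op_affine_maps \<and>
                        \<phi> holomorphic_on unit_disk \<and> inj_on \<phi> unit_disk}"
    unfolding class_S_def H0 using inj_comp univalent by blast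
qed

end
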